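(* Let $\lambda>1$. The following hold. (i) If a basis $\mathcal{B}$ of a Banach space is strong partially greedy, then $\mathcal{B}$ is $\lambda$-partially greedy. (ii) There exists a Banach space with an unconditional basis $\mathcal{B}$ that is $\lambda$-partially greedy but is not strong partially greedy.
   Context: Let $(X,\|\cdot\|)$ be an infinite-dimensional Banach space over $\mathbb{K}=\mathbb{R}$ or $\mathbb{C}$ with dual $(X^*,\|\cdot\|_* )$. A basis of $X$ is a sequence $\mathcal{B}=(e_n)_{n=1}^\infty$ in $X$ such that: (1) there is a unique sequence $(e_n^* )_{n=1}^\infty$ in $X^*$ with $e_i^*(e_j)=\delta_{i,j}$ for all $i,j$; (2) $\sup_n\|e_n\|\|e_n^*\|_*<\infty$ and $0<\inf_n\|e_n\|\leqslant\sup_n\|e_n\|<\infty$; (3) $X$ is the norm-closed linear span of $\{e_n\}$; (4) $X^*$ is the weak$^*$-closed linear span of $\{e_n^*\}$. Notation: $\mathbb{N}_0=\mathbb{N}\cup\{0\}$. For $A\subset\mathbb{N}$, $P_A(x)=\sum_{n\in A}e_n^*(x)e_n$ (for infinite $A$, the series is required to converge). $S_n(x)=\sum_{i=1}^n e_i^*(x)e_i$. A finite set $\Lambda\subset\mathbb{N}$ is a greedy set of $x\in X$ if $\min_{n\in\Lambda}|e_n^*(x)|\geqslant\max_{n\notin\Lambda}|e_n^*(x)|$ (the empty set is a greedy set of every $x$). For $m\in\mathbb{N}_0$, $\gamma_m(x)=\sup\{\|x-P_\Lambda(x)\|:\Lambda\text{ is a greedy set of }x,\ |\Lambda|=m\}$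 and $\widehat{\sigma}_m(x)=\inf\{\|x-S_n(x)\|:0\leqslant n\leqslant m\}$. $\mathcal{B}$ is unconditional if there is $C\geqslant 1$ with $\|P_A(x)\|\leqslant C\|x\|$ for all $x\in X$ and $A\subset\mathbb{N}$. $\mathcal{B}$ is strong partially greedy if there is $C\geqslant 1$ with $\gamma_m(x)\leqslant C\widehat{\sigma}_m(x)$ for all $x\in X$, $m\in\mathbb{N}_0$. $\mathcal{B}$ is $\lambda$-partially greedy if there is $C_\lambda\geqslant 1$ with $\gamma_{\lceil\lambda m\rceil}(x)\leqslant C_\lambda\widehat{\sigma}_m(x)$ for all $x\in X$, $m\in\mathbb{N}_0$. *)

theory Defs
  imports "HOL-Analysis.Analysis" "HOL-Library.Function_Algebras"
begin

(* Banach spaces are rendered with an explicit carrier X, a linear subspace of an ambient vector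
   space 'b over the scalar field 'k (to be instantiated with real and with complex).  The
   library's banach class is for real scalars only, and without a carrier set one could not
   assert the existence of a space.  Operations outside X are irrelevant. *)

locale banach_space_on = vector_space scale
  for scale :: "'k::real_normed_field \<Rightarrow> 'b::ab_group_add \<Rightarrow> 'b"  (infixr \<open>*s\<close> 75) +
  fixes X :: "'b set" and nrm :: "'b \<Rightarrow> real"
  assumes subspace_X: "subspace X"
    and nrm_nonneg: "x \<in> X \<Longrightarrow> 0 \<le> nrm x"
    and nrm_eq_0_iff: "x \<in> X \<Longrightarrow> nrm x = 0 \<longleftrightarrow> x = 0"
    and nrm_scale: "x \<in> X \<Longrightarrow> nrm (a *s x) = norm a * nrm x"
    and nrm_triangle: "x \<in> X \<Longrightarrow> y \<in> X \<Longrightarrow> nrm (x + y) \<le> nrm x + nrm y"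
    and complete_X:
      "Metric_space.mcomplete X (\<lambda>x y. if x \<in> X \<and> y \<in> X then nrm (x - y) else 0)"
begin

(* The value outside X only serves to meet the global symmetry and nonnegativity requirements
   of Metric_space. *)
definition nrm_dist :: "'b \<Rightarrow> 'b \<Rightarrow> real" where
  "nrm_dist x y = (if x \<in> X \<and> y \<in> X then nrm (x - y) else 0)"

definition norm_topology :: "'b topology" where
  "norm_topology = Metric_space.mtopology X nrm_dist"

definition infinite_dimensional :: bool where
  "infinite_dimensional \<longleftrightarrow> \<not> (\<exists>S. finite S \<and> S \<subseteq> X \<and> span S = X)"

(* Functionals are extensional, i.e. undefined outside X, so that equality of functionals
   is equality on X. *)
definition dual :: "('b \<Rightarrow> 'k) set" where
  "dual = {f \<in> extensional X.
     (\<forall>x\<in>X. \<forall>y\<in>X. f (x + y) = f x + f y) \<and>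
     (\<forall>a. \<forall>x\<in>X. f (a *s x) = a * f x) \<and>
     (\<exists>B. \<forall>x\<in>X. norm (f x) \<le> B * nrm x)}"

definition dual_norm :: "('b \<Rightarrow> 'k) \<Rightarrow> real" where
  "dual_norm f = (SUP x\<in>{x \<in> X. nrm x \<le> 1}. norm (f x))"

definition weak_star_topology :: "('b \<Rightarrow> 'k) topology" where
  "weak_star_topology = subtopology (product_topology (\<lambda>_. euclidean) X) dual"

definition dual_span :: "(nat \<Rightarrow> 'b \<Rightarrow> 'k) \<Rightarrow> ('b \<Rightarrow> 'k) set" where
  "dual_span f = {restrict (\<lambda>x. \<Sum>n<N. c n * f n x) X | (N :: nat) (c :: nat \<Rightarrow> 'k). True}"

definition biorthogonal :: "(nat \<Rightarrow> 'b) \<Rightarrow> (nat \<Rightarrow> 'b \<Rightarrow> 'k) \<Rightarrow> bool" where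
  "biorthogonal e f \<longleftrightarrow>
     (\<forall>n. f n \<in> dual) \<and> (\<forall>i j. f i (e j) = (if i = j then 1 else 0))"

definition coord :: "(nat \<Rightarrow> 'b) \<Rightarrow> nat \<Rightarrow> 'b \<Rightarrow> 'k" where
  "coord e = (THE f. biorthogonal e f)"

(* Sequences are indexed from 0: e n is the (n+1)-st basis vector. *)
definition is_basis :: "(nat \<Rightarrow> 'b) \<Rightarrow> bool" where
  "is_basis e \<longleftrightarrow>
     range e \<subseteq> X \<and>
     (\<exists>!f. biorthogonal e f) \<and>
     bdd_above (range (\<lambda>n. nrm (e n) * dual_norm (coord e n))) \<and>
     0 < (INF n. nrm (e n)) \<and> bdd_above (range (\<lambda>n. nrm (e n))) \<and>
     norm_topology closure_of (span (range e)) = X \<and>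
     weak_star_topology closure_of (dual_span (coord e)) = dual"

definition proj_sums :: "(nat \<Rightarrow> 'b) \<Rightarrow> nat set \<Rightarrow> 'b \<Rightarrow> nat \<Rightarrow> 'b" where
  "proj_sums e A x N = (\<Sum>n\<in>A \<inter> {..<N}. coord e n x *s e n)"

definition proj_converges :: "(nat \<Rightarrow> 'b) \<Rightarrow> nat set \<Rightarrow> 'b \<Rightarrow> bool" where
  "proj_converges e A x \<longleftrightarrow> (\<exists>y. limitin norm_topology (proj_sums e A x) y sequentially)"

definition proj :: "(nat \<Rightarrow> 'b) \<Rightarrow> nat set \<Rightarrow> 'b \<Rightarrow> 'b" where
  "proj e A x = (if finite A then \<Sum>n\<in>A. coord e n x *s e n
     else THE y. limitin norm_topology (proj_sums e A x) y sequentially)"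

definition partial_sum :: "(nat \<Rightarrow> 'b) \<Rightarrow> nat \<Rightarrow> 'b \<Rightarrow> 'b" where
  "partial_sum e n x = (\<Sum>i<n. coord e i x *s e i)"

definition greedy_set :: "(nat \<Rightarrow> 'b) \<Rightarrow> 'b \<Rightarrow> nat set \<Rightarrow> bool" where
  "greedy_set e x \<Lambda> \<longleftrightarrow>
     finite \<Lambda> \<and> (\<forall>n\<in>\<Lambda>. \<forall>k. k \<notin> \<Lambda> \<longrightarrow> norm (coord e k x) \<le> norm (coord e n x))"

(* For a basis e and x in X the coefficients of x tend to 0, so the set below is nonempty
   and finite, and its real supremum is the intended one. *)
definition greedy_error :: "(nat \<Rightarrow> 'b) \<Rightarrow> nat \<Rightarrow> 'b \<Rightarrow> real" where
  "greedy_error e m x = Sup {nrm (x - proj e \<Lambda> x) | \<Lambda>. greedy_set e x \<Lambda> \<and> card \<Lambda> = m}"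

definition partial_sum_error :: "(nat \<Rightarrow> 'b) \<Rightarrow> nat \<Rightarrow> 'b \<Rightarrow> real" where
  "partial_sum_error e m x = (INF n\<in>{..m}. nrm (x - partial_sum e n x))"

definition unconditional :: "(nat \<Rightarrow> 'b) \<Rightarrow> bool" where
  "unconditional e \<longleftrightarrow>
     (\<exists>C\<ge>1. \<forall>x\<in>X. \<forall>A. proj_converges e A x \<and> nrm (proj e A x) \<le> C * nrm x)"

definition strong_partially_greedy :: "(nat \<Rightarrow> 'b) \<Rightarrow> bool" where
  "strong_partially_greedy e \<longleftrightarrow>
     (\<exists>C\<ge>1. \<forall>x\<in>X. \<forall>m. greedy_error e m x \<le> C * partial_sum_error e m x)"

definition partially_greedy :: "real \<Rightarrow> (nat \<Rightarrow> 'b) \<Rightarrow> bool" where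
  "partially_greedy lam e \<longleftrightarrow>
     (\<exists>C\<ge>1. \<forall>x\<in>X. \<forall>m. greedy_error e (nat \<lceil>lam * real m\<rceil>) x \<le> C * partial_sum_error e m x)"

end

locale banach_space_with_basis = banach_space_on +
  fixes e :: "nat \<Rightarrow> 'b"
  assumes infinite_dim: infinite_dimensional
    and basis: "is_basis e"

end

theory Submission
  imports Defs
begin

text \<open>The first part holds because \<open>\<lceil>\<lambda> m\<rceil> \<ge> m\<close> for \<open>\<lambda> \<ge> 1\<close>, and the best error of approximation by partial
sums of length at most \<open>m\<close> decreases when \<open>m\<close> grows.

For the second part, take the space of scalar sequences with the norm
\<open>\<parallel>x\<parallel> = (\<Sum>\<^sub>n |x\<^sub>n|\<^sup>2)\<^sup>1\<^sup>/\<^sup>2 + \<Sum>\<^sub>k |x(k\<^sup>2)|\<close>, an \<open>\<ell>\<^sub>2\<close> norm that is strengthened to an \<open>\<ell>\<^sub>1\<close> norm on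
the sparse set of squares. The norm depends only on the moduli of the coordinates and is monotone in
them, so the unit vectors form an unconditional basis; this part of the argument works for every
\<open>solid_sequence_space\<close>. For a finite set \<open>A\<close> of indices write \<open>1\<^sub>A\<close> for its indicator sequence.

Strong partial greediness would force \<open>\<parallel>1\<^sub>A\<parallel> \<le> C \<parallel>1\<^sub>B\<parallel>\<close> whenever \<open>A\<close> lies to the left of \<open>B\<close> and
\<open>|A| = |B|\<close>. If \<open>A\<close> consists of \<open>k\<close> squares and \<open>B\<close> of \<open>k\<close> nonsquares, then the left norm is
\<open>k + \<surd>k\<close> and the right norm is \<open>\<surd>k\<close>, so no \<open>C\<close> works
(\<open>mixed_not_strong_partially_greedy\<close>).

If instead a greedy set \<open>\<Lambda>\<close> has \<open>\<lceil>\<lambda> n\<rceil>\<close> elements, then at least \<open>(\<lambda> - 1) n\<close> of them lie to the right of the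
first \<open>n\<close> indices. Let \<open>A\<close> be the part of the first \<open>n\<close> indices that \<open>\<Lambda>\<close> misses, and \<open>B\<close> the part of \<open>\<Lambda>\<close>
to the right. As there are only \<open>O(\<surd>n)\<close> squares below \<open>n\<close>, the \<open>\<ell>\<^sub>1\<close> part does no harm on \<open>A\<close>:
\<open>\<parallel>1\<^sub>A\<parallel> \<le> 3\<surd>n\<close> (\<open>mixed_le_sqrt\<close>), whereas \<open>\<parallel>1\<^sub>B\<parallel> \<ge> \<surd>((\<lambda> - 1) n)\<close> (\<open>sqrt_le_mixed\<close>). The coefficients
on \<open>A\<close> are dominated by those on \<open>B\<close>, which survive in the tail, so the coordinates in \<open>A\<close> cost at
most the factor \<open>3 / \<surd>(\<lambda> - 1)\<close> (\<open>mixed_greedy_remainder_le\<close>).\<close>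

section \<open>Strong partial greediness\<close>

lemma (in banach_space_with_basis) partial_sum_error_antimono:
  assumes "x \<in> X" "m \<le> m'"
  shows "partial_sum_error e m' x \<le> partial_sum_error e m x"
  unfolding partial_sum_error_def
proof (rule cINF_superset_mono)
  show "bdd_below ((\<lambda>n. nrm (x - partial_sum e n x)) ` {..m'})"
    by simp
qed (use assms in auto)

theorem (in banach_space_with_basis) strong_partially_greedy_imp_partially_greedy:
  assumes "lam \<ge> 1" "strong_partially_greedy e"
  shows "partially_greedy lam e"
proof -
  obtain C where C: "C \<ge> 1" 
    "\<And>x m. x \<in> X \<Longrightarrow> greedy_error e m x \<le> C * partial_sum_error e m x"
    using assms(2) unfolding strong_partially_greedy_def by blast
  have "greedy_error e (nat \<lceil>lam * real m\<rceil>) x \<le> C * partial_sum_error e m x" if x: "x \<in> X" for x m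
  proof -
    have "real m \<le> lam * real m"
      using assms(1) by (simp add: mult_le_cancel_right1)
    then have "m \<le> nat \<lceil>lam * real m\<rceil>"
      by linarith
    then have "C * partial_sum_error e (nat \<lceil>lam * real m\<rceil>) x \<le> C * partial_sum_error e m x"
      using partial_sum_error_antimono[OF x] C(1) by (intro mult_left_mono) auto
    with C(2)[OF x] show ?thesis
      by (rule order_trans)
  qed
  with C(1) show ?thesis
    unfolding partially_greedy_def by blast
qed

section \<open>Solid sequence spaces\<close>

lemma in_closure_of_limitin:
  assumes "limitin T f l F" "F \<noteq> bot" "\<And>i. f i \<in> S"
  shows "l \<in> T closure_of S"
proof -
  have "\<exists>y. y \<in> S \<and> y \<in> U" if "openin T U" "l \<in> U" for U
  proof -
    have "eventually (\<lambda>i. f i \<in> U) F"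
      using assms(1) that by (simp add: limitin_def)
    then show ?thesis
      using assms(2,3) eventually_happens by blast
  qed
  moreover have "l \<in> topspace T"
    using assms(1) by (simp add: limitin_def)
  ultimately show ?thesis
    by (auto simp: in_closure_of)
qed

lemma sum_fun_apply: "sum f A n = (\<Sum>i\<in>A. f i n)"
  by (induction A rule: infinite_finite_induct) auto

definition seq_scale :: "'k::times \<Rightarrow> (nat \<Rightarrow> 'k) \<Rightarrow> nat \<Rightarrow> 'k" where
  "seq_scale a x = (\<lambda>n. a * x n)"

definition unit_seq :: "nat \<Rightarrow> nat \<Rightarrow> 'k::zero_neq_one" where
  "unit_seq n = (\<lambda>k. if k = n then 1 else 0)"

definition restr :: "nat set \<Rightarrow> (nat \<Rightarrow> 'k::zero) \<Rightarrow> nat \<Rightarrow> 'k" where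
  "restr A x = (\<lambda>n. if n \<in> A then x n else 0)"

lemma seq_scale_apply [simp]: "seq_scale a x n = a * x n"
  by (simp add: seq_scale_def)

lemma unit_seq_apply: "unit_seq n k = (if k = n then 1 else 0)"
  by (simp add: unit_seq_def)

lemma restr_apply: "restr A x n = (if n \<in> A then x n else 0)"
  by (simp add: restr_def)

lemma diff_restr: "x - restr A x = restr (- A) (x :: nat \<Rightarrow> 'k::ab_group_add)"
  by (auto simp: restr_def fun_eq_iff)

lemma sum_unit_seq:
  assumes "finite A"
  shows "(\<Sum>n\<in>A. seq_scale (x n) (unit_seq n)) = restr A (x :: nat \<Rightarrow> 'k::real_normed_field)"
proof
  fix k
  show "(\<Sum>n\<in>A. seq_scale (x n) (unit_seq n)) k = restr A x k"
    using assms by (simp add: sum_fun_apply restr_def unit_seq_apply if_distrib[of "\<lambda>z. _ * z"] cong: if_cong)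
qed

text \<open>The hypotheses are chosen so that they carry everything except the estimates that are
special to one norm: solidity makes the unit vectors unconditional, \<open>fatou\<close> gives completeness, and
\<open>tails\<close> (order continuity) makes the finitely supported sequences dense, both in the space and,
through the coordinate functionals, in the weak$^*$ topology of the dual.\<close>

locale solid_sequence_space =
  fixes E :: "(nat \<Rightarrow> 'k::{real_normed_field,banach}) set" and nu :: "(nat \<Rightarrow> 'k) \<Rightarrow> real"
  assumes add_closed: "x \<in> E \<Longrightarrow> y \<in> E \<Longrightarrow> x + y \<in> E"
    and nu_triangle: "x \<in> E \<Longrightarrow> y \<in> E \<Longrightarrow> nu (x + y) \<le> nu x + nu y"
    and scale_closed: "x \<in> E \<Longrightarrow> seq_scale a x \<in> E"
    and nu_scale: "x \<in> E \<Longrightarrow> nu (seq_scale a x) = norm a * nu x"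
    and solid_closed: "x \<in> E \<Longrightarrow> (\<And>n. norm (y n) \<le> norm (x n)) \<Longrightarrow> y \<in> E"
    and nu_solid: "x \<in> E \<Longrightarrow> (\<And>n. norm (y n) \<le> norm (x n)) \<Longrightarrow> nu y \<le> nu x"
    and coord_le_nu: "x \<in> E \<Longrightarrow> norm (x n) \<le> nu x"
    and unit_in_E: "unit_seq n \<in> E"
    and nu_unit_bdd: "bdd_above (range (\<lambda>n. nu (unit_seq n)))"
    and fatou: "(\<And>i :: nat. s i \<in> E) \<Longrightarrow> (\<And>i. nu (s i) \<le> B) \<Longrightarrow>
          (\<And>n. (\<lambda>i. s i n) \<longlonglongrightarrow> x n) \<Longrightarrow> x \<in> E \<and> nu x \<le> B"
    and tails: "x \<in> E \<Longrightarrow> (\<lambda>m. nu (restr {m..} x)) \<longlonglongrightarrow> 0"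
begin

lemma nu_ge_0: "x \<in> E \<Longrightarrow> 0 \<le> nu x"
  by (meson coord_le_nu norm_ge_zero order_trans)

lemma zero_in_E: "0 \<in> E"
  by (rule solid_closed[OF unit_in_E]) auto

lemma nu_zero: "nu 0 = 0"
proof -
  have "seq_scale 0 0 = (0 :: nat \<Rightarrow> 'k)"
    by auto
  then show ?thesis
    using nu_scale[OF zero_in_E, of 0] by simp
qed

lemma nu_eq_0_iff: "x \<in> E \<Longrightarrow> nu x = 0 \<longleftrightarrow> x = 0"
  using coord_le_nu[of x] by (metis ext nu_zero norm_le_zero_iff zero_fun_apply)

lemma diff_eq_add_scale: "x - y = x + seq_scale (-1) (y :: nat \<Rightarrow> 'k)"
  by auto

lemma diff_closed: "x \<in> E \<Longrightarrow> y \<in> E \<Longrightarrow> x - y \<in> E"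
  unfolding diff_eq_add_scale by (intro add_closed scale_closed)

lemma nu_diff_commute: "x \<in> E \<Longrightarrow> y \<in> E \<Longrightarrow> nu (x - y) = nu (y - x)"
  by (intro antisym nu_solid diff_closed) (simp_all add: norm_minus_commute)

lemma restr_closed: "x \<in> E \<Longrightarrow> restr A x \<in> E"
  by (erule solid_closed) (auto simp: restr_def)

lemma nu_restr_mono: "x \<in> E \<Longrightarrow> A \<subseteq> B \<Longrightarrow> nu (restr A x) \<le> nu (restr B x)"
  by (rule nu_solid[OF restr_closed]) (auto simp: restr_def)

lemma nu_restr_le: "x \<in> E \<Longrightarrow> nu (restr A x) \<le> nu x"
  by (rule nu_solid) (auto simp: restr_def)

subsection \<open>The Banach space\<close>

lemma vector_space_seq_scale: "vector_space (seq_scale :: 'k \<Rightarrow> _)"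
  by unfold_locales (auto simp: fun_eq_iff algebra_simps)

abbreviation nu_dist :: "(nat \<Rightarrow> 'k) \<Rightarrow> (nat \<Rightarrow> 'k) \<Rightarrow> real" where
  "nu_dist x y \<equiv> (if x \<in> E \<and> y \<in> E then nu (x - y) else 0)"

lemma metric_space_nu: "Metric_space E nu_dist"
proof
  fix x y z assume "x \<in> E" "y \<in> E" "z \<in> E"
  then show "nu_dist x z \<le> nu_dist x y + nu_dist y z"
    using nu_triangle[of "x - y" "y - z"] by (simp add: diff_closed)
qed (auto simp: nu_ge_0 diff_closed nu_diff_commute nu_eq_0_iff)

lemma limitin_nu:
  "limitin (Metric_space.mtopology E nu_dist) y x sequentially \<longleftrightarrow>
     x \<in> E \<and> eventually (\<lambda>i. y i \<in> E) sequentially \<and> (\<lambda>i. nu (y i - x)) \<longlonglongrightarrow> 0"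
proof -
  have *: "(\<lambda>i. nu_dist (y i) x) \<longlonglongrightarrow> 0 \<longleftrightarrow> (\<lambda>i. nu (y i - x)) \<longlonglongrightarrow> 0"
    if "x \<in> E" "eventually (\<lambda>i. y i \<in> E) sequentially"
    by (rule filterlim_cong[OF refl refl]) (use that in \<open>auto elim: eventually_mono\<close>)
  show ?thesis
    unfolding Metric_space.limitin_metric_dist_null[OF metric_space_nu] using * by blast
qed

lemma mcomplete_nu: "Metric_space.mcomplete E nu_dist"
  unfolding Metric_space.mcomplete_def[OF metric_space_nu]
proof (intro allI impI)
  fix y assume Cauchy_y: "Metric_space.MCauchy E nu_dist y"
  have yE: "y i \<in> E" for i
    using Cauchy_y unfolding Metric_space.MCauchy_def[OF metric_space_nu] by blast
  have small: "\<exists>i0. \<forall>i\<ge>i0. \<forall>j\<ge>i0. nu (y i - y j) < eps" if "eps > 0" for eps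
    using Cauchy_y that yE unfolding Metric_space.MCauchy_def[OF metric_space_nu] by simp
  have "Cauchy (\<lambda>i. y i n)" for n
    unfolding Cauchy_def
  proof (intro allI impI)
    fix eps :: real assume "eps > 0"
    from small[OF this] obtain i0 where i0: "\<And>i j. i \<ge> i0 \<Longrightarrow> j \<ge> i0 \<Longrightarrow> nu (y i - y j) < eps"
      by blast
    have "dist (y i n) (y j n) < eps" if "i \<ge> i0" "j \<ge> i0" for i j
      using coord_le_nu[OF diff_closed[OF yE yE], of i j n] i0[OF that] by (simp add: dist_norm)
    then show "\<exists>M. \<forall>m\<ge>M. \<forall>k\<ge>M. dist (y m n) (y k n) < eps"
      by blast
  qed
  then have "\<exists>l. (\<lambda>i. y i n) \<longlonglongrightarrow> l" for n
    using Cauchy_convergent_iff convergent_def by blast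
  then obtain x where x: "\<And>n. (\<lambda>i. y i n) \<longlonglongrightarrow> x n"
    by metis
  have close: "\<exists>i0. \<forall>i\<ge>i0. y i - x \<in> E \<and> nu (y i - x) \<le> eps" if "eps > 0" for eps
  proof -
    from small[OF that] obtain i0 where i0: "\<And>i j. i \<ge> i0 \<Longrightarrow> j \<ge> i0 \<Longrightarrow> nu (y i - y j) < eps"
      by blast
    \<comment> \<open>The Cauchy estimate passes to the coordinatewise limit in the second argument.\<close>
    have "y i - x \<in> E \<and> nu (y i - x) \<le> eps" if i: "i \<ge> i0" for i
    proof (rule fatou)
      show "y i - y (j + i0) \<in> E" for j
        by (intro diff_closed yE)
      show "nu (y i - y (j + i0)) \<le> eps" for j
        using i0[OF i, of "j + i0"] by simp
      show "(\<lambda>j. (y i - y (j + i0)) n) \<longlonglongrightarrow> (y i - x) n" for n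
        using LIMSEQ_ignore_initial_segment[OF x[of n], of i0] by (auto intro!: tendsto_intros)
    qed
    then show ?thesis
      by blast
  qed
  \<comment> \<open>The coordinatewise limit lies in the space because it differs from some \<open>y i\<close> by an element of it.\<close>
  have xE: "x \<in> E"
  proof -
    obtain i where "y i - x \<in> E"
      using close[of 1] by auto
    then have "y i - (y i - x) \<in> E"
      by (rule diff_closed[OF yE])
    then show ?thesis
      by simp
  qed
  have "(\<lambda>i. nu (y i - x)) \<longlonglongrightarrow> 0"
    unfolding LIMSEQ_def
  proof (intro allI impI)
    fix r :: real assume "r > 0"
    with close[of "r/2"] obtain i0 where "\<And>i. i \<ge> i0 \<Longrightarrow> nu (y i - x) \<le> r/2"
      by auto
    then have "dist (nu (y i - x)) 0 < r" if "i \<ge> i0" for i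
      using that \<open>r > 0\<close> nu_ge_0[OF diff_closed[OF yE xE], of i] by fastforce
    then show "\<exists>i0. \<forall>i\<ge>i0. dist (nu (y i - x)) 0 < r"
      by blast
  qed
  with xE yE show "\<exists>x. limitin (Metric_space.mtopology E nu_dist) y x sequentially"
    by (auto simp: limitin_nu)
qed

sublocale banach_space_on seq_scale E nu
proof (intro banach_space_on.intro vector_space_seq_scale banach_space_on_axioms.intro)
  interpret vector_space "seq_scale :: 'k \<Rightarrow> _"
    by (rule vector_space_seq_scale)
  show "module.subspace seq_scale E"
    by (simp add: subspace_def zero_in_E add_closed scale_closed)
qed (auto simp: nu_ge_0 nu_eq_0_iff nu_scale nu_triangle mcomplete_nu)

lemma nrm_dist_eq: "nrm_dist = nu_dist"
  by (auto simp: nrm_dist_def fun_eq_iff)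

lemma limitin_norm_topology:
  "limitin norm_topology y x sequentially \<longleftrightarrow>
     x \<in> E \<and> eventually (\<lambda>i. y i \<in> E) sequentially \<and> (\<lambda>i. nu (y i - x)) \<longlonglongrightarrow> 0"
  by (simp add: norm_topology_def nrm_dist_eq limitin_nu)

lemma limitin_restr_lessThan:
  assumes "x \<in> E"
  shows "limitin norm_topology (\<lambda>m. restr {..<m} x) x sequentially"
proof -
  have "nu (restr {..<m} x - x) = nu (restr {m..} x)" for m
  proof -
    have "nu (restr {..<m} x - x) = nu (x - restr {..<m} x)"
      using assms by (intro nu_diff_commute restr_closed)
    also have "\<dots> = nu (restr {m..} x)"
      by (simp add: diff_restr Compl_lessThan)
    finally show ?thesis .
  qed
  with assms tails[OF assms] show ?thesis
    by (simp add: limitin_norm_topology restr_closed)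
qed

subsection \<open>The unit vector basis\<close>

text \<open>The unit vectors are independent: every vector in the span of the others has the coordinate
in question equal to 0.\<close>

lemma infinite_dimensional: infinite_dimensional
  unfolding infinite_dimensional_def
proof (rule notI, elim exE conjE)
  fix S assume S: "finite S" "span S = E"
  have inj: "inj (unit_seq :: nat \<Rightarrow> nat \<Rightarrow> 'k)"
  proof (rule injI)
    fix i j assume "(unit_seq i :: nat \<Rightarrow> 'k) = unit_seq j"
    then have "(unit_seq i i :: 'k) = unit_seq j i"
      by simp
    then show "i = j"
      by (simp add: unit_seq_apply split: if_splits)
  qed
  have "independent (range unit_seq :: (nat \<Rightarrow> 'k) set)"
    unfolding dependent_def
  proof safe
    fix n assume n: "(unit_seq n :: nat \<Rightarrow> 'k) \<in> span (range unit_seq - {unit_seq n})"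
    have "span (range unit_seq - {unit_seq n}) \<subseteq> {x. x n = (0 :: 'k)}"
    proof (rule span_minimal)
      show "range unit_seq - {unit_seq n} \<subseteq> {x. x n = (0 :: 'k)}"
        by (auto simp: unit_seq_apply)
      show "subspace {x. x n = (0 :: 'k)}"
        by (auto simp: subspace_def)
    qed
    with n show False
      by (auto simp: unit_seq_apply)
  qed
  moreover have "range unit_seq \<subseteq> span S"
    using S unit_in_E by auto
  ultimately have "finite (range unit_seq :: (nat \<Rightarrow> 'k) set)"
    using independent_span_bound[OF S(1)] by blast
  then show False
    using finite_imageD[OF _ inj] by simp
qed

text \<open>This one expansion gives both the uniqueness of the biorthogonal functionals, since a bounded
functional is determined by its values on the unit vectors, and the weak$^*$ density of the span
of the coordinate functionals.\<close>

lemma dual_eval_tendsto: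
  assumes f: "f \<in> dual" and x: "x \<in> E"
  shows "(\<lambda>m. \<Sum>n<m. x n * f (unit_seq n)) \<longlonglongrightarrow> f x"
proof -
  obtain B where add: "\<And>x y. x \<in> E \<Longrightarrow> y \<in> E \<Longrightarrow> f (x + y) = f x + f y"
    and scale: "\<And>a x. x \<in> E \<Longrightarrow> f (seq_scale a x) = a * f x"
    and B: "\<And>x. x \<in> E \<Longrightarrow> norm (f x) \<le> B * nu x"
    using f unfolding dual_def by blast
  have sum_eq: "f (restr {..<m} x) = (\<Sum>n<m. x n * f (unit_seq n))" for m
  proof (induction m)
    case 0
    have "restr {..<0} x = seq_scale 0 x"
      by (auto simp: restr_def)
    then have "f (restr {..<0} x) = 0 * f x"
      using scale[OF x] by metis
    then show ?case
      by simp
  next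
    case (Suc m)
    have "restr {..<Suc m} x = restr {..<m} x + seq_scale (x m) (unit_seq m)"
      by (auto simp: restr_def unit_seq_apply fun_eq_iff less_Suc_eq)
    then have "f (restr {..<Suc m} x) = f (restr {..<m} x) + x m * f (unit_seq m)"
      by (simp add: add scale restr_closed x scale_closed unit_in_E)
    with Suc show ?case
      by simp
  qed
  have "norm (f (restr {..<m} x) - f x) \<le> B * nu (restr {m..} x)" for m
  proof -
    have "x = restr {..<m} x + restr {m..} x"
      by (auto simp: restr_def fun_eq_iff)
    then have "f x = f (restr {..<m} x) + f (restr {m..} x)"
      using add restr_closed x by metis
    then show ?thesis
      using B[OF restr_closed[OF x], of "{m..}"] by simp
  qed
  moreover have "(\<lambda>m. B * nu (restr {m..} x)) \<longlonglongrightarrow> 0"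
    using tendsto_mult_right_zero[OF tails[OF x]] .
  ultimately have "(\<lambda>m. f (restr {..<m} x) - f x) \<longlonglongrightarrow> 0"
    by (rule Lim_null_comparison[OF always_eventually, OF allI])
  then show ?thesis
    unfolding sum_eq[symmetric] by (rule LIM_zero_cancel)
qed

lemma biorthogonal_unit_seq_iff:
  "biorthogonal unit_seq f \<longleftrightarrow> f = (\<lambda>n. restrict (\<lambda>x. x n) E)"
proof
  assume f: "biorthogonal unit_seq f"
  show "f = (\<lambda>n. restrict (\<lambda>x. x n) E)"
  proof (intro ext)
    fix n x
    show "f n x = restrict (\<lambda>x. x n) E x"
    proof (cases "x \<in> E")
      case True
      have "(\<lambda>m. \<Sum>k<m. x k * f n (unit_seq k)) \<longlonglongrightarrow> f n x"
        using f True by (intro dual_eval_tendsto) (auto simp: biorthogonal_def)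
      moreover have "eventually (\<lambda>m. (\<Sum>k<m. x k * f n (unit_seq k)) = x n) sequentially"
        by (rule eventually_mono[OF eventually_gt_at_top[of n]])
          (use f in \<open>simp add: biorthogonal_def if_distrib[of "\<lambda>z. _ * z"] cong: if_cong\<close>)
      ultimately have "f n x = x n"
        by (rule LIMSEQ_unique[OF _ tendsto_eventually])
      with True show ?thesis
        by simp
    next
      case False
      with f show ?thesis
        by (auto simp: biorthogonal_def dual_def extensional_def)
    qed
  qed
next
  have "\<exists>B. \<forall>x\<in>E. norm (x n) \<le> B * nu x" for n
    by (intro exI[of _ 1]) (simp add: coord_le_nu)
  then have "restrict (\<lambda>x. x n) E \<in> dual" for n
    unfolding dual_def using add_closed scale_closed by auto
  then show "biorthogonal unit_seq f" if "f = (\<lambda>n. restrict (\<lambda>x. x n) E)"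
    using that by (auto simp: biorthogonal_def unit_in_E unit_seq_apply)
qed

lemma coord_unit_seq: "coord unit_seq = (\<lambda>n. restrict (\<lambda>x. x n) E)"
  unfolding coord_def biorthogonal_unit_seq_iff by simp

lemma coord_unit_seq_apply: "x \<in> E \<Longrightarrow> coord unit_seq n x = x n"
  by (simp add: coord_unit_seq)

lemma dual_norm_coord_le: "dual_norm (coord unit_seq n) \<le> 1"
  unfolding dual_norm_def
proof (rule cSUP_least)
  show "{x \<in> E. nu x \<le> 1} \<noteq> {}"
    using zero_in_E nu_zero by (intro ex_in_conv[THEN iffD1] exI[of _ 0]) simp
next
  fix x assume "x \<in> {x \<in> E. nu x \<le> 1}"
  then show "norm (coord unit_seq n x) \<le> 1"
    using coord_le_nu[of x n] by (simp add: coord_unit_seq_apply)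
qed

lemma dense_span: "norm_topology closure_of (span (range unit_seq)) = E"
proof
  have "topspace norm_topology = E"
    by (simp add: norm_topology_def nrm_dist_eq Metric_space.topspace_mtopology[OF metric_space_nu])
  then show "norm_topology closure_of (span (range unit_seq)) \<subseteq> E"
    by (metis closure_of_subset_topspace)
  show "E \<subseteq> norm_topology closure_of (span (range unit_seq))"
  proof
    fix x assume "x \<in> E"
    show "x \<in> norm_topology closure_of (span (range unit_seq))"
    proof (rule in_closure_of_limitin[OF limitin_restr_lessThan[OF \<open>x \<in> E\<close>]])
      fix m
      have "(\<Sum>n<m. seq_scale (x n) (unit_seq n)) \<in> span (range unit_seq)"
        by (intro span_sum span_scale span_base) auto
      then show "restr {..<m} x \<in> span (range unit_seq)"
        by (simp add: sum_unit_seq)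
    qed simp
  qed
qed

lemma weak_star_dense: "weak_star_topology closure_of (dual_span (coord unit_seq)) = dual"
proof
  have top: "topspace weak_star_topology = dual"
    by (auto simp: weak_star_topology_def dual_def PiE_def)
  then show "weak_star_topology closure_of (dual_span (coord unit_seq)) \<subseteq> dual"
    by (metis closure_of_subset_topspace)
  show "dual \<subseteq> weak_star_topology closure_of (dual_span (coord unit_seq))"
  proof
    fix f assume f: "f \<in> dual"
    \<comment> \<open>\<open>g m\<close> is \<open>f\<close> composed with the \<open>m\<close>-th partial sum operator.\<close>
    define g where "g m = restrict (\<lambda>x. \<Sum>n<m. f (unit_seq n) * coord unit_seq n x) E" for m
    have g_span: "g m \<in> dual_span (coord unit_seq)" for m
      unfolding dual_span_def g_def
      by (intro CollectI exI[of _ m] exI[of _ "\<lambda>n. f (unit_seq n)"]) simp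
    have g_dual: "g m \<in> dual" for m
    proof -
      have "\<exists>B. \<forall>x\<in>E. norm (g m x) \<le> B * nu x"
      proof (intro exI ballI)
        fix x assume x: "x \<in> E"
        have "norm (g m x) \<le> (\<Sum>n<m. norm (f (unit_seq n)) * nu x)"
          using x by (auto simp: g_def coord_unit_seq_apply norm_mult
              intro!: sum_norm_le mult_left_mono coord_le_nu)
        then show "norm (g m x) \<le> (\<Sum>n<m. norm (f (unit_seq n))) * nu x"
          by (simp add: sum_distrib_right)
      qed
      then show ?thesis
        unfolding dual_def
        by (auto simp: g_def coord_unit_seq_apply add_closed scale_closed ring_distribs
            sum.distrib sum_distrib_left mult_ac)
    qed
    have "limitin weak_star_topology g f sequentially"
      unfolding weak_star_topology_def limitin_subtopology limitin_componentwise
    proof (intro conjI ballI)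
      show "f \<in> extensional E"
        using f by (simp add: dual_def)
      show "eventually (\<lambda>m. g m \<in> topspace (product_topology (\<lambda>_. euclidean) E)) sequentially"
        by (simp add: g_def PiE_def)
      fix x assume x: "x \<in> E"
      show "limitin euclidean (\<lambda>m. g m x) (f x) sequentially"
        using dual_eval_tendsto[OF f x] x
        by (simp add: g_def coord_unit_seq_apply mult.commute)
    qed (use f g_dual in auto)
    then show "f \<in> weak_star_topology closure_of (dual_span (coord unit_seq))"
      by (rule in_closure_of_limitin) (use g_span in auto)
  qed
qed

lemma is_basis_unit_seq: "is_basis unit_seq"
  unfolding is_basis_def
proof (intro conjI dense_span weak_star_dense nu_unit_bdd)
  show "range unit_seq \<subseteq> E"
    using unit_in_E by auto
  show "\<exists>!f. biorthogonal unit_seq f"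
    by (simp add: biorthogonal_unit_seq_iff)
  obtain M where M: "\<And>n. nu (unit_seq n) \<le> M"
    using nu_unit_bdd by (auto simp: bdd_above_def)
  have "nu (unit_seq n) * dual_norm (coord unit_seq n) \<le> M" for n
    using mult_left_mono[OF dual_norm_coord_le nu_ge_0[OF unit_in_E], of n n] M[of n] by simp
  then show "bdd_above (range (\<lambda>n. nu (unit_seq n) * dual_norm (coord unit_seq n)))"
    by (auto simp: bdd_above_def)
  have "1 \<le> nu (unit_seq n)" for n
    using coord_le_nu[OF unit_in_E, of n n] by (simp add: unit_seq_apply)
  then have "1 \<le> (INF n. nu (unit_seq n))"
    by (intro cINF_greatest) auto
  then show "0 < (INF n. nu (unit_seq n))"
    by simp
qed

lemma banach_space_with_basis_unit_seq: "banach_space_with_basis seq_scale E nu unit_seq"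
  by unfold_locales (rule infinite_dimensional is_basis_unit_seq)+

subsection \<open>Projections and greedy sets\<close>

lemma limitin_proj_sums:
  assumes x: "x \<in> E"
  shows "limitin norm_topology (proj_sums unit_seq A x) (restr A x) sequentially"
proof -
  have "proj_sums unit_seq A x m = restr {..<m} (restr A x)" for m
    by (simp add: proj_sums_def coord_unit_seq_apply x sum_unit_seq)
       (auto simp: restr_def fun_eq_iff)
  then show ?thesis
    using limitin_restr_lessThan[OF restr_closed[OF x]] by presburger
qed

lemma proj_unit_seq: 
  assumes x: "x \<in> E"
  shows "proj unit_seq A x = restr A x"
proof (cases "finite A")
  case True
  with x show ?thesis
    by (simp add: proj_def coord_unit_seq_apply sum_unit_seq)
next
  case False
  have "y = z" if "limitin norm_topology s y sequentially" "limitin norm_topology s z sequentially" for s y z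
    using Metric_space.limitin_metric_unique[OF metric_space_nu, of s y sequentially z] that
    by (simp add: norm_topology_def nrm_dist_eq)
  then have "(THE y. limitin norm_topology (proj_sums unit_seq A x) y sequentially) = restr A x"
    using limitin_proj_sums[OF x] by blast
  with False show ?thesis
    by (simp add: proj_def)
qed

lemma unconditional_unit_seq: "unconditional unit_seq"
  unfolding unconditional_def proj_converges_def
  using limitin_proj_sums nu_restr_le
  by (intro exI[of _ 1]) (auto simp: proj_unit_seq)

lemma partial_sum_unit_seq: "x \<in> E \<Longrightarrow> partial_sum unit_seq n x = restr {..<n} x"
  by (simp add: partial_sum_def coord_unit_seq_apply sum_unit_seq)

lemma greedy_set_unit_seq_iff:
  "x \<in> E \<Longrightarrow> greedy_set unit_seq x \<Lambda> \<longleftrightarrow>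
     finite \<Lambda> \<and> (\<forall>n\<in>\<Lambda>. \<forall>k. k \<notin> \<Lambda> \<longrightarrow> norm (x k) \<le> norm (x n))"
  by (simp add: greedy_set_def coord_unit_seq_apply)

lemma coords_tendsto_0:
  assumes "x \<in> E"
  shows "x \<longlonglongrightarrow> 0"
proof (rule Lim_null_comparison[OF always_eventually tails[OF assms]], rule allI)
  fix n
  show "norm (x n) \<le> nu (restr {n..} x)"
    using coord_le_nu[OF restr_closed[OF assms], of "{n..}" n] by (simp add: restr_apply)
qed

text \<open>The maximum is attained because the coordinates tend to 0, so that only finitely many of them
exceed a given nonzero one.\<close>

lemma ex_max_coord:
  assumes x: "x \<in> E" and S: "S \<noteq> {}"
  shows "\<exists>k\<in>S. \<forall>j\<in>S. norm (x j) \<le> norm (x k)"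
proof (cases "\<forall>j\<in>S. x j = 0")
  case True
  with S show ?thesis
    by auto
next
  case False
  then obtain i where i: "i \<in> S" "x i \<noteq> 0"
    by blast
  obtain m where m: "\<And>n. n \<ge> m \<Longrightarrow> norm (x n) < norm (x i)"
    using LIMSEQ_D[OF coords_tendsto_0[OF x], of "norm (x i)"] i by auto
  define T where "T = {j\<in>S. norm (x i) \<le> norm (x j)}"
  have "T \<subseteq> {..<m}"
    using m by (force simp: T_def not_le[symmetric])
  then have "finite T"
    using finite_subset by blast
  moreover have "T \<noteq> {}"
    using i by (auto simp: T_def)
  ultimately obtain k where k: "k \<in> T" "\<And>j. j \<in> T \<Longrightarrow> norm (x j) \<le> norm (x k)"
    using obtains_MAX[of T "\<lambda>j. norm (x j)"] by (metis Max_ge finite_imageI imageI)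
  have "norm (x j) \<le> norm (x k)" if "j \<in> S" for j
    using that k by (cases "j \<in> T") (auto simp: T_def)
  with k(1) show ?thesis
    by (auto simp: T_def)
qed

text \<open>Greedy sets of every cardinality arise by adding one largest remaining coordinate at a time.
Their existence keeps the supremum that defines \<open>greedy_error\<close> from being the supremum of the
empty set, about which nothing is known.\<close>

lemma ex_greedy_set:
  assumes x: "x \<in> E"
  shows "\<exists>\<Lambda>. greedy_set unit_seq x \<Lambda> \<and> card \<Lambda> = m"
proof (induction m)
  case 0
  show ?case
    unfolding greedy_set_unit_seq_iff[OF x] by (rule exI[of _ "{}"]) simp
next
  case (Suc m)
  then obtain L where L: "greedy_set unit_seq x L" "card L = m"
    by blast
  from L(1) have fin: "finite L" 
    and dom: "\<And>n k. n \<in> L \<Longrightarrow> k \<notin> L \<Longrightarrow> norm (x k) \<le> norm (x n)"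
    unfolding greedy_set_unit_seq_iff[OF x] by auto
  obtain i where "i \<notin> L"
    using ex_new_if_finite[OF infinite_UNIV_nat fin] by blast
  then obtain k where k: "k \<notin> L" "\<And>j. j \<notin> L \<Longrightarrow> norm (x j) \<le> norm (x k)"
    using ex_max_coord[OF x, of "- L"] by auto
  then have "greedy_set unit_seq x (insert k L)"
    unfolding greedy_set_unit_seq_iff[OF x] using fin dom by auto
  moreover have "card (insert k L) = Suc m"
    using L(2) fin k(1) by simp
  ultimately show ?case
    by blast
qed

lemma greedy_error_le:
  assumes x: "x \<in> E" 
    and "\<And>\<Lambda>. greedy_set unit_seq x \<Lambda> \<Longrightarrow> card \<Lambda> = m \<Longrightarrow> nu (restr (- \<Lambda>) x) \<le> B"
  shows "greedy_error unit_seq m x \<le> B"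
  unfolding greedy_error_def
  using assms ex_greedy_set[OF x, of m]
  by (intro cSup_least) (auto simp: proj_unit_seq diff_restr)

lemma greedy_error_ge:
  assumes x: "x \<in> E" and "greedy_set unit_seq x \<Lambda>" "card \<Lambda> = m"
  shows "nu (restr (- \<Lambda>) x) \<le> greedy_error unit_seq m x"
  unfolding greedy_error_def
proof (rule cSup_upper)
  show "nu (restr (- \<Lambda>) x) \<in> {nu (x - proj unit_seq \<Lambda> x) |\<Lambda>. greedy_set unit_seq x \<Lambda> \<and> card \<Lambda> = m}"
    using assms by (force simp: proj_unit_seq diff_restr)
  show "bdd_above {nu (x - proj unit_seq \<Lambda> x) |\<Lambda>. greedy_set unit_seq x \<Lambda> \<and> card \<Lambda> = m}"
    using nu_restr_le[OF x] by (auto simp: proj_unit_seq diff_restr x bdd_above_def)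
qed

text \<open>By solidity the longest admissible partial sum is the best one.\<close>

lemma partial_sum_error_eq:
  "x \<in> E \<Longrightarrow> partial_sum_error unit_seq m x = nu (restr {m..} x)"
  unfolding partial_sum_error_def
  by (intro cInf_eq_minimum) (auto simp: partial_sum_unit_seq diff_restr Compl_lessThan intro!: nu_restr_mono)

end

section \<open>The sum of the square norm and of the absolute sum over the squares\<close>

definition squares :: "nat set" where
  "squares = range (\<lambda>k. k\<^sup>2)"

text \<open>The contribution of the coordinates in \<open>A\<close> to the norm. Defining the norm as a supremum of such
finite pieces lets the axioms of a solid space be checked on finite sums.\<close>

definition mixed :: "(nat \<Rightarrow> 'k::real_normed_field) \<Rightarrow> nat set \<Rightarrow> real" where
  "mixed x A = L2_set (\<lambda>n. norm (x n)) A + (\<Sum>n\<in>A \<inter> squares. norm (x n))"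

definition mixed_space :: "(nat \<Rightarrow> 'k::real_normed_field) set" where
  "mixed_space = {x. bdd_above (range (\<lambda>m. mixed x {..<m}))}"

definition mixed_norm :: "(nat \<Rightarrow> 'k::real_normed_field) \<Rightarrow> real" where
  "mixed_norm x = (SUP m. mixed x {..<m})"

lemma mixed_mono:
  assumes "\<And>n. n \<in> A \<Longrightarrow> norm (x n) \<le> norm (y n)"
  shows "mixed x A \<le> mixed y A"
  unfolding mixed_def using assms by (intro add_mono L2_set_mono sum_mono) auto

lemma mixed_mono_set:
  assumes "finite B" "A \<subseteq> B"
  shows "mixed x A \<le> mixed x B"
  unfolding mixed_def L2_set_def using assms
  by (intro add_mono real_sqrt_le_mono sum_mono2) auto

lemma mixed_restr:
  assumes "finite B"
  shows "mixed (restr A x) B = mixed x (A \<inter> B)"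
proof -
  have "(\<Sum>n\<in>B. (norm (restr A x n))\<^sup>2) = (\<Sum>n\<in>A \<inter> B. (norm (x n))\<^sup>2)"
    using assms by (intro sum.mono_neutral_cong_right) (auto simp: restr_apply)
  moreover have "(\<Sum>n\<in>B \<inter> squares. norm (restr A x n)) = (\<Sum>n\<in>(A \<inter> B) \<inter> squares. norm (x n))"
    using assms by (intro sum.mono_neutral_cong_right) (auto simp: restr_apply)
  ultimately show ?thesis
    by (simp add: mixed_def L2_set_def)
qed

lemma mixed_triangle: "mixed (x + y) A \<le> mixed x A + mixed y A"
proof -
  have "L2_set (\<lambda>n. norm ((x + y) n)) A \<le> L2_set (\<lambda>n. norm (x n) + norm (y n)) A"
    by (intro L2_set_mono) (auto simp: norm_triangle_ineq)
  also have "\<dots> \<le> L2_set (\<lambda>n. norm (x n)) A + L2_set (\<lambda>n. norm (y n)) A"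
    by (rule L2_set_triangle_ineq)
  finally have "L2_set (\<lambda>n. norm ((x + y) n)) A \<le> \<dots>" .
  moreover have "(\<Sum>n\<in>A \<inter> squares. norm ((x + y) n)) 
      \<le> (\<Sum>n\<in>A \<inter> squares. norm (x n)) + (\<Sum>n\<in>A \<inter> squares. norm (y n))"
    by (simp add: sum.distrib[symmetric] sum_mono norm_triangle_ineq)
  ultimately show ?thesis
    by (simp add: mixed_def)
qed

lemma mixed_scale: "mixed (seq_scale a x) A = norm a * mixed x A"
  by (simp add: mixed_def norm_mult L2_set_right_distrib sum_distrib_left distrib_left)

lemma mixed_le_mixed_norm:
  assumes "x \<in> mixed_space" "finite A"
  shows "mixed x A \<le> mixed_norm x"
proof -
  obtain m where "A \<subseteq> {..<m}"
    using assms(2) finite_nat_iff_bounded by blast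
  then have "mixed x A \<le> mixed x {..<m}"
    by (intro mixed_mono_set) auto
  also have "\<dots> \<le> mixed_norm x"
    using assms(1) unfolding mixed_space_def mixed_norm_def by (intro cSUP_upper) auto
  finally show ?thesis .
qed

lemma mixed_norm_le:
  assumes "\<And>m. mixed x {..<m} \<le> B"
  shows "x \<in> mixed_space \<and> mixed_norm x \<le> B"
  unfolding mixed_space_def mixed_norm_def using assms
  by (auto intro: cSUP_least simp: bdd_above_def)

lemma mixed_norm_restr_le:
  assumes "finite A"
  shows "restr A x \<in> mixed_space \<and> mixed_norm (restr A x) \<le> mixed x A"
  using assms by (intro mixed_norm_le) (simp add: mixed_restr mixed_mono_set)

lemma mixed_norm_scale:
  assumes "x \<in> mixed_space"
  shows "seq_scale a x \<in> mixed_space \<and> mixed_norm (seq_scale a x) = norm a * mixed_norm x"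
proof (cases "a = 0")
  case True
  have "mixed_norm (seq_scale a x) = 0"
    using True by (simp add: mixed_norm_def mixed_scale)
  with True show ?thesis
    using mixed_norm_le[of "seq_scale a x" 0] by (simp add: mixed_scale)
next
  case False
  have le: "seq_scale a x \<in> mixed_space \<and> mixed_norm (seq_scale a x) \<le> norm a * mixed_norm x"
    using assms by (intro mixed_norm_le) (simp add: mixed_scale mixed_le_mixed_norm mult_left_mono)
  have "mixed x {..<m} \<le> mixed_norm (seq_scale a x) / norm a" for m
    using mixed_le_mixed_norm[of "seq_scale a x" "{..<m}"] le False
    by (simp add: mixed_scale field_simps)
  then have "mixed_norm x \<le> mixed_norm (seq_scale a x) / norm a"
    using mixed_norm_le by blast
  with le False show ?thesis
    by (simp add: field_simps)
qed

text \<open>Both the squares of the moduli and the moduli on the squares are summable, so by the Cauchy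
criterion the pieces of \<open>x\<close> far out are uniformly small.\<close>

lemma mixed_tails:
  assumes x: "x \<in> mixed_space"
  shows "(\<lambda>m. mixed_norm (restr {m..} x)) \<longlonglongrightarrow> 0"
proof -
  define w where "w n = (if n \<in> squares then norm (x n) else 0)" for n
  have sum_w: "sum w A = (\<Sum>n\<in>A \<inter> squares. norm (x n))" if "finite A" for A
    using that by (simp add: w_def sum.inter_restrict)
  have bounds: "L2_set (\<lambda>n. norm (x n)) {..<m} \<le> mixed_norm x" "sum w {..<m} \<le> mixed_norm x" for m
  proof -
    have "L2_set (\<lambda>n. norm (x n)) {..<m} + sum w {..<m} \<le> mixed_norm x"
      using mixed_le_mixed_norm[OF x, of "{..<m}"] by (simp add: mixed_def sum_w)
    moreover have "0 \<le> L2_set (\<lambda>n. norm (x n)) {..<m}" "0 \<le> sum w {..<m}"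
      by (auto simp: w_def intro: sum_nonneg)
    ultimately show "L2_set (\<lambda>n. norm (x n)) {..<m} \<le> mixed_norm x" "sum w {..<m} \<le> mixed_norm x"
      by linarith+
  qed
  have "(\<Sum>n<m. (norm (x n))\<^sup>2) \<le> (mixed_norm x)\<^sup>2" for m
    using bounds(1)[of m] unfolding L2_set_def by (rule sqrt_le_D)
  then have summable_sq: "summable (\<lambda>n. (norm (x n))\<^sup>2)"
    by (intro bounded_imp_summable[where B = "(mixed_norm x)\<^sup>2"]) (auto simp: lessThan_Suc_atMost[symmetric] simp del: sum.lessThan_Suc)
  have summable_w: "summable w"
    using bounds(2) by (intro bounded_imp_summable[where B = "mixed_norm x"]) 
      (auto simp: w_def lessThan_Suc_atMost[symmetric] simp del: sum.lessThan_Suc)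
  show ?thesis
    unfolding LIMSEQ_def
  proof (intro allI impI)
    fix r :: real assume r: "r > 0"
    obtain m1 where m1: "\<And>m n. m \<ge> m1 \<Longrightarrow> norm (\<Sum>k=m..<n. (norm (x k))\<^sup>2) < (r/3)\<^sup>2"
      using summable_sq[unfolded summable_Cauchy] r by (meson zero_less_power divide_pos_pos zero_less_numeral)
    obtain m2 where m2: "\<And>m n. m \<ge> m2 \<Longrightarrow> norm (sum w {m..<n}) < r/3"
      using summable_w[unfolded summable_Cauchy] r by (meson divide_pos_pos zero_less_numeral)
    have "dist (mixed_norm (restr {m..} x)) 0 < r" if m: "m \<ge> max m1 m2" for m
    proof -
      have "mixed (restr {m..} x) {..<n} \<le> 2 * (r/3)" for n
      proof -
        have "{m..} \<inter> {..<n} = {m..<n}"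
          by auto
        then have "mixed (restr {m..} x) {..<n} = L2_set (\<lambda>n. norm (x n)) {m..<n} + sum w {m..<n}"
          by (simp add: mixed_restr) (simp add: mixed_def sum_w)
        moreover have "L2_set (\<lambda>n. norm (x n)) {m..<n} \<le> r/3"
          unfolding L2_set_def using m1[of m n] m r by (intro real_le_lsqrt) auto
        moreover have "sum w {m..<n} \<le> r/3"
          using m2[of m n] m by simp
        ultimately show ?thesis
          by simp
      qed
      then have *: "restr {m..} x \<in> mixed_space \<and> mixed_norm (restr {m..} x) \<le> 2 * (r/3)"
        by (rule mixed_norm_le)
      then have "0 \<le> mixed_norm (restr {m..} x)"
        using mixed_le_mixed_norm[of "restr {m..} x" "{}"] by (simp add: mixed_def)
      with * r show ?thesis
        by simp
    qed
    then show "\<exists>m0. \<forall>m\<ge>m0. dist (mixed_norm (restr {m..} x)) 0 < r"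
      by blast
  qed
qed

interpretation mixed: solid_sequence_space
  "mixed_space :: (nat \<Rightarrow> 'k::{real_normed_field,banach}) set" mixed_norm
proof
  fix x y :: "nat \<Rightarrow> 'k" assume x: "x \<in> mixed_space" and y: "y \<in> mixed_space"
  have "mixed (x + y) {..<m} \<le> mixed_norm x + mixed_norm y" for m
    using mixed_triangle[of x y "{..<m}"] mixed_le_mixed_norm[OF x, of "{..<m}"] 
      mixed_le_mixed_norm[OF y, of "{..<m}"] by simp
  then have "x + y \<in> mixed_space \<and> mixed_norm (x + y) \<le> mixed_norm x + mixed_norm y"
    by (rule mixed_norm_le)
  then show "x + y \<in> mixed_space" "mixed_norm (x + y) \<le> mixed_norm x + mixed_norm y"
    by blast+
next
  fix x :: "nat \<Rightarrow> 'k" and a assume x: "x \<in> mixed_space"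
  from mixed_norm_scale[OF x] 
  show "seq_scale a x \<in> mixed_space" "mixed_norm (seq_scale a x) = norm a * mixed_norm x"
    by blast+
next
  fix x y :: "nat \<Rightarrow> 'k" assume x: "x \<in> mixed_space" and y: "\<And>n. norm (y n) \<le> norm (x n)"
  have "mixed y {..<m} \<le> mixed_norm x" for m
    using mixed_mono[of "{..<m}" y x] mixed_le_mixed_norm[OF x, of "{..<m}"] y by force
  then have "y \<in> mixed_space \<and> mixed_norm y \<le> mixed_norm x"
    by (rule mixed_norm_le)
  then show "y \<in> mixed_space" "mixed_norm y \<le> mixed_norm x"
    by blast+
next
  fix x :: "nat \<Rightarrow> 'k" and n assume x: "x \<in> mixed_space"
  have "norm (x n) \<le> mixed x {n}"
    by (simp add: mixed_def sum_nonneg)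
  then show "norm (x n) \<le> mixed_norm x"
    using mixed_le_mixed_norm[OF x, of "{n}"] by simp
next
  have unit: "unit_seq n = restr {n} (unit_seq n :: nat \<Rightarrow> 'k)" for n
    by (auto simp: restr_def unit_seq_def)
  show "(unit_seq n :: nat \<Rightarrow> 'k) \<in> mixed_space" for n
    using mixed_norm_restr_le[of "{n}" "unit_seq n :: nat \<Rightarrow> 'k"] unfolding unit[symmetric] by simp
  have "mixed (unit_seq n :: nat \<Rightarrow> 'k) {n} \<le> 2" for n
    by (simp add: mixed_def unit_seq_apply Int_insert_left)
  then have "mixed_norm (unit_seq n :: nat \<Rightarrow> 'k) \<le> 2" for n
    using mixed_norm_restr_le[of "{n}" "unit_seq n :: nat \<Rightarrow> 'k"] unfolding unit[symmetric]
    by (meson finite.emptyI finite.insertI order_trans)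
  then show "bdd_above (range (\<lambda>n. mixed_norm (unit_seq n :: nat \<Rightarrow> 'k)))"
    by (auto simp: bdd_above_def)
next
  fix s :: "nat \<Rightarrow> nat \<Rightarrow> 'k" and x B
  assume s: "\<And>i. s i \<in> mixed_space" "\<And>i. mixed_norm (s i) \<le> B" 
    and lim: "\<And>n. (\<lambda>i. s i n) \<longlonglongrightarrow> x n"
  have "mixed x {..<m} \<le> B" for m
  proof (rule LIMSEQ_le_const2)
    show "(\<lambda>i. mixed (s i) {..<m}) \<longlonglongrightarrow> mixed x {..<m}"
      unfolding mixed_def L2_set_def by (intro tendsto_intros lim)
    show "\<exists>i0. \<forall>i\<ge>i0. mixed (s i) {..<m} \<le> B"
      using s mixed_le_mixed_norm[OF s(1)] by (meson finite_lessThan order_trans)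
  qed
  then show "x \<in> mixed_space \<and> mixed_norm x \<le> B"
    by (rule mixed_norm_le)
qed (rule mixed_tails)

section \<open>Greedy approximation in the mixed norm\<close>

lemma card_squares_lessThan: "card ({..<k\<^sup>2} \<inter> squares) = k"
proof -
  have "j\<^sup>2 < k\<^sup>2 \<longleftrightarrow> j < k" for j
    by (auto intro: power_strict_mono dest: power_less_imp_less_base)
  then have "{..<k\<^sup>2} \<inter> squares = (\<lambda>j. j\<^sup>2) ` {..<k}"
    by (auto simp: squares_def)
  moreover have "inj_on (\<lambda>j::nat. j\<^sup>2) {..<k}"
    by (auto simp: inj_on_def)
  ultimately show ?thesis
    by (simp add: card_image)
qed

text \<open>Rounding \<open>n\<close> up to the square of \<open>\<lceil>\<surd>n\<rceil>\<close> reduces the count to an exact one, and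
\<open>\<lceil>\<surd>n\<rceil> \<le> \<surd>n + 1 \<le> 2\<surd>n\<close> for \<open>n \<ge> 1\<close>.\<close>

lemma card_squares_le: "real (card ({..<n} \<inter> squares)) \<le> 2 * sqrt n"
proof (cases "n = 0")
  case False
  define k where "k = nat \<lceil>sqrt n\<rceil>"
  have "sqrt n \<le> k"
    by (simp add: k_def)
  then have "(sqrt n)\<^sup>2 \<le> (real k)\<^sup>2"
    by (intro power_mono) auto
  then have "real n \<le> real (k\<^sup>2)"
    by simp
  then have "{..<n} \<subseteq> {..<k\<^sup>2}"
    by auto
  then have "card ({..<n} \<inter> squares) \<le> card ({..<k\<^sup>2} \<inter> squares)"
    by (intro card_mono) auto
  also have "\<dots> = k"
    by (rule card_squares_lessThan)
  also have "real k \<le> sqrt n + 1"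
    by (simp add: k_def)
  also have "\<dots> \<le> 2 * sqrt n"
    using False by simp
  finally show ?thesis
    by simp
qed simp

text \<open>The square norm contributes at most \<open>a\<surd>n\<close>, and the sum over the at most \<open>2\<surd>n\<close> squares below
\<open>n\<close> at most \<open>2a\<surd>n\<close>: at this scale the two parts of the norm are comparable.\<close>

lemma mixed_le_sqrt:
  assumes A: "A \<subseteq> {..<n}" and x: "\<And>k. k \<in> A \<Longrightarrow> norm (x k) \<le> a" and a: "0 \<le> a"
  shows "mixed x A \<le> 3 * (a * sqrt n)"
proof -
  have fin: "finite A"
    using A finite_subset by blast
  have "(\<Sum>k\<in>A. (norm (x k))\<^sup>2) \<le> real (card A) * a\<^sup>2"
    using x by (intro sum_bounded_above power_mono) auto
  also have "\<dots> \<le> n * a\<^sup>2"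
    using card_mono[OF _ A] by (intro mult_right_mono) auto
  finally have "L2_set (\<lambda>n. norm (x n)) A \<le> sqrt (n * a\<^sup>2)"
    unfolding L2_set_def by (rule real_sqrt_le_mono)
  also have "\<dots> = a * sqrt n"
    using a by (simp add: real_sqrt_mult)
  finally have "L2_set (\<lambda>n. norm (x n)) A \<le> a * sqrt n" .
  moreover have "(\<Sum>k\<in>A \<inter> squares. norm (x k)) \<le> real (card (A \<inter> squares)) * a"
    using x by (intro sum_bounded_above) auto
  moreover have "card (A \<inter> squares) \<le> card ({..<n} \<inter> squares)"
    using A by (intro card_mono) auto
  then have "real (card (A \<inter> squares)) * a \<le> (2 * sqrt n) * a"
    using card_squares_le[of n] a by (intro mult_right_mono) auto
  moreover have "3 * (a * sqrt n) = a * sqrt n + (2 * sqrt n) * a"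
    by simp
  ultimately show ?thesis
    unfolding mixed_def by linarith
qed

lemma sqrt_le_mixed:
  assumes B: "finite B" and x: "\<And>k. k \<in> B \<Longrightarrow> a \<le> norm (x k)" and a: "0 \<le> a"
  shows "a * sqrt (card B) \<le> mixed x B"
proof -
  have "real (card B) * a\<^sup>2 \<le> (\<Sum>k\<in>B. (norm (x k))\<^sup>2)"
    using x a by (intro sum_bounded_below power_mono) auto
  then have "sqrt (real (card B) * a\<^sup>2) \<le> L2_set (\<lambda>n. norm (x n)) B"
    unfolding L2_set_def by (rule real_sqrt_le_mono)
  moreover have "sqrt (real (card B) * a\<^sup>2) = a * sqrt (card B)"
    using a by (simp add: real_sqrt_mult)
  ultimately show ?thesis
    by (simp add: mixed_def sum_nonneg add_increasing2)
qed

text \<open>The remainder splits into the part from \<open>n\<close> on, which solidity bounds by the tail, and the part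
on the set \<open>A\<close> of the first \<open>n\<close> indices that \<open>\<Lambda>\<close> misses. The latter is paid for by the
at least \<open>(\<lambda> - 1) n\<close> larger coordinates that \<open>\<Lambda>\<close> has in the tail.\<close>

lemma mixed_greedy_remainder_le:
  fixes x :: "nat \<Rightarrow> 'k::{real_normed_field,banach}"
  assumes lam: "lam > 1" and x: "x \<in> mixed_space"
    and greedy: "mixed.greedy_set unit_seq x \<Lambda>" and card: "card \<Lambda> = nat \<lceil>lam * real n\<rceil>"
  shows "mixed_norm (restr (- \<Lambda>) x) \<le> (1 + 3 / sqrt (lam - 1)) * mixed_norm (restr {n..} x)"
proof -
  define A where "A = {..<n} - \<Lambda>"
  define B where "B = \<Lambda> - {..<n}"
  define tail where "tail = mixed_norm (restr {n..} x)"
  have fin: "finite \<Lambda>" "finite A" "finite B"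
    and dom: "\<And>k j. k \<in> A \<Longrightarrow> j \<in> B \<Longrightarrow> norm (x k) \<le> norm (x j)"
    using greedy by (auto simp: A_def B_def mixed.greedy_set_unit_seq_iff[OF x])
  have tail_in: "restr {n..} x \<in> mixed_space"
    by (rule mixed.restr_closed[OF x])
  \<comment> \<open>The largest modulus on \<open>A\<close>; inserting 0 covers the case that \<open>A\<close> is empty.\<close>
  define a where "a = Max (insert 0 ((\<lambda>k. norm (x k)) ` A))"
  have a: "0 \<le> a" "\<And>k. k \<in> A \<Longrightarrow> norm (x k) \<le> a"
    using fin by (auto simp: a_def)
  have aB: "a \<le> norm (x j)" if "j \<in> B" for j
    using fin dom[OF _ that] by (auto simp: a_def)
  have card_B: "(lam - 1) * real n \<le> real (card B)"
  proof -
    have "card \<Lambda> \<le> card (B \<union> {..<n})"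
      using fin by (intro card_mono) (auto simp: B_def)
    also have "\<dots> \<le> card B + n"
      using card_Un_le[of B "{..<n}"] by simp
    finally have "real (nat \<lceil>lam * real n\<rceil>) \<le> card B + n"
      using card by linarith
    moreover have "lam * real n \<le> real (nat \<lceil>lam * real n\<rceil>)"
      by linarith
    ultimately show ?thesis
      by (simp add: algebra_simps)
  qed
  have "sqrt (lam - 1) * (a * sqrt n) = a * sqrt ((lam - 1) * real n)"
    by (simp add: real_sqrt_mult)
  also have "\<dots> \<le> a * sqrt (card B)"
    using card_B a by (intro mult_left_mono) auto
  also have "\<dots> \<le> mixed x B"
    using fin aB a by (intro sqrt_le_mixed) auto
  also have "\<dots> = mixed (restr {n..} x) B"
    using fin by (auto simp: mixed_restr B_def Int_absorb1 subset_iff not_less)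
  also have "\<dots> \<le> tail"
    unfolding tail_def using fin tail_in by (intro mixed_le_mixed_norm)
  finally have a_le: "a * sqrt n \<le> tail / sqrt (lam - 1)"
    using lam by (simp add: field_simps)
  have "restr (- \<Lambda>) x = restr ({n..} - \<Lambda>) x + restr A x"
    by (auto simp: restr_def A_def fun_eq_iff)
  then have "mixed_norm (restr (- \<Lambda>) x) \<le> mixed_norm (restr ({n..} - \<Lambda>) x) + mixed_norm (restr A x)"
    using mixed.nu_triangle mixed.restr_closed x by metis
  moreover have "mixed_norm (restr ({n..} - \<Lambda>) x) \<le> tail"
    unfolding tail_def by (intro mixed.nu_restr_mono x) auto
  moreover have "mixed_norm (restr A x) \<le> 3 * (tail / sqrt (lam - 1))"
  proof -
    have "mixed_norm (restr A x) \<le> mixed x A"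
      using mixed_norm_restr_le fin by blast
    also have "\<dots> \<le> 3 * (a * sqrt n)"
      using a by (intro mixed_le_sqrt) (auto simp: A_def)
    finally show ?thesis
      using a_le by linarith
  qed
  ultimately show ?thesis
    by (simp add: tail_def algebra_simps)
qed

theorem mixed_partially_greedy:
  assumes lam: "lam > 1"
  shows "mixed.partially_greedy lam (unit_seq :: nat \<Rightarrow> nat \<Rightarrow> 'k::{real_normed_field,banach})"
  unfolding mixed.partially_greedy_def
proof (intro exI conjI ballI allI)
  show "1 \<le> 1 + 3 / sqrt (lam - 1)"
    using lam by simp
  fix x :: "nat \<Rightarrow> 'k" and m assume x: "x \<in> mixed_space"
  show "mixed.greedy_error unit_seq (nat \<lceil>lam * real m\<rceil>) x
      \<le> (1 + 3 / sqrt (lam - 1)) * mixed.partial_sum_error unit_seq m x"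
    unfolding mixed.partial_sum_error_eq[OF x]
    by (intro mixed.greedy_error_le x mixed_greedy_remainder_le lam)
qed

text \<open>The interval from \<open>k\<^sup>2 + 1\<close> to \<open>k\<^sup>2 + k\<close> contains no square. Take the indicator sequence of this
interval together with all indices below \<open>k\<^sup>2\<close>. As all nonzero coefficients are equal, any subset of
the support is greedy, in particular the set \<open>\<Lambda>\<close> of the \<open>k\<^sup>2\<close> nonsquares in it. Removing \<open>\<Lambda>\<close>
leaves the \<open>k\<close> squares, of norm at least \<open>k\<close>, whereas removing the first \<open>k\<^sup>2\<close> coordinates leaves
\<open>k\<close> nonsquares, of norm \<open>\<surd>k\<close>.\<close>

theorem mixed_not_strong_partially_greedy:
  "\<not> mixed.strong_partially_greedy (unit_seq :: nat \<Rightarrow> nat \<Rightarrow> 'k::{real_normed_field,banach})"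
proof
  assume "mixed.strong_partially_greedy (unit_seq :: nat \<Rightarrow> nat \<Rightarrow> 'k)"
  then obtain C where C: "C \<ge> 1" "\<And>(x :: nat \<Rightarrow> 'k) m. x \<in> mixed_space \<Longrightarrow> 
      mixed.greedy_error unit_seq m x \<le> C * mixed.partial_sum_error unit_seq m x"
    unfolding mixed.strong_partially_greedy_def by blast
  define k where "k = nat \<lceil>C\<^sup>2\<rceil> + 1"
  have k: "C\<^sup>2 < real k"
    unfolding k_def by linarith
  define B where "B = {k\<^sup>2<..k\<^sup>2 + k}"
  define \<Lambda> where "\<Lambda> = ({..<k\<^sup>2} - squares) \<union> B"
  define x :: "nat \<Rightarrow> 'k" where "x = restr ({..<k\<^sup>2} \<union> B) 1"
  have x: "x \<in> mixed_space"
    unfolding x_def using mixed_norm_restr_le[of "{..<k\<^sup>2} \<union> B" "1 :: nat \<Rightarrow> 'k"] by (simp add: B_def)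
  have B_squares: "B \<inter> squares = {}"
  proof -
    have False if "k\<^sup>2 < j\<^sup>2" "j\<^sup>2 \<le> k\<^sup>2 + k" for j
    proof -
      have "k < j"
        using that(1) by (rule power_less_imp_less_base) simp
      then have "(Suc k)\<^sup>2 \<le> j\<^sup>2"
        by (intro power_mono) auto
      with that(2) show False
        by (simp add: power2_eq_square)
    qed
    then show ?thesis
      by (auto simp: B_def squares_def)
  qed
  have card_\<Lambda>: "card \<Lambda> = k\<^sup>2"
  proof -
    have "card ({..<k\<^sup>2} - squares) + k = k\<^sup>2"
      using card_Int_Diff[of "{..<k\<^sup>2}" squares] card_squares_lessThan[of k] by simp
    moreover have "card \<Lambda> = card ({..<k\<^sup>2} - squares) + card B"
      unfolding \<Lambda>_def by (rule card_Un_disjoint) (auto simp: B_def)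
    ultimately show ?thesis
      by (simp add: B_def)
  qed
  have "mixed.greedy_set unit_seq x \<Lambda>"
    unfolding mixed.greedy_set_unit_seq_iff[OF x] by (auto simp: \<Lambda>_def B_def x_def restr_apply)
  then have "mixed_norm (restr (- \<Lambda>) x) \<le> mixed.greedy_error unit_seq (k\<^sup>2) x"
    using card_\<Lambda> x by (intro mixed.greedy_error_ge)
  also have "\<dots> \<le> C * mixed_norm (restr {k\<^sup>2..} x)"
    using C(2)[OF x, of "k\<^sup>2"] by (simp add: mixed.partial_sum_error_eq[OF x])
  also have "mixed_norm (restr {k\<^sup>2..} x) \<le> sqrt k"
  proof -
    have "restr {k\<^sup>2..} x = restr B 1"
      by (auto simp: x_def restr_def B_def fun_eq_iff)
    then have "mixed_norm (restr {k\<^sup>2..} x) \<le> mixed (1 :: nat \<Rightarrow> 'k) B"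
      using mixed_norm_restr_le[of B "1 :: nat \<Rightarrow> 'k"] by (simp add: B_def)
    also have "\<dots> = sqrt k"
      unfolding mixed_def B_squares by (simp add: L2_set_def B_def)
    finally show ?thesis .
  qed
  finally have "mixed_norm (restr (- \<Lambda>) x) \<le> C * sqrt k"
    using C(1) by (simp add: mult_left_mono)
  moreover have "k \<le> mixed_norm (restr (- \<Lambda>) x)"
  proof -
    define S where "S = {..<k\<^sup>2} \<inter> squares"
    have fin: "finite S"
      by (simp add: S_def)
    have "real k = (\<Sum>n\<in>S. norm (restr (- \<Lambda>) x n))"
    proof -
      have "norm (restr (- \<Lambda>) x n) = 1" if "n \<in> S" for n
        using that B_squares by (auto simp: S_def \<Lambda>_def x_def restr_apply)
      then show ?thesis
        using card_squares_lessThan[of k] by (simp add: S_def)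
    qed
    also have "\<dots> \<le> mixed (restr (- \<Lambda>) x) S"
    proof -
      have "S \<inter> squares = S"
        by (auto simp: S_def)
      then show ?thesis
        by (simp add: mixed_def)
    qed
    also have "\<dots> \<le> mixed_norm (restr (- \<Lambda>) x)"
      using fin by (intro mixed_le_mixed_norm mixed.restr_closed x)
    finally show ?thesis .
  qed
  ultimately have "sqrt k * sqrt k \<le> C * sqrt k"
    by simp
  moreover have "sqrt k > 0"
    using le_less_trans[OF zero_le_power2 k] by (simp only: real_sqrt_gt_0_iff)
  ultimately have "sqrt k \<le> C"
    by (rule mult_right_le_imp_le)
  then have "real k \<le> C\<^sup>2"
    by (rule sqrt_le_D)
  with k show False
    by simp
qed

theorem theorem1p8:
  fixes lam :: real
  assumes "lam > 1"
  shows
    "(\<forall>(scale :: real \<Rightarrow> 'a::ab_group_add \<Rightarrow> 'a) X nrm e.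
        banach_space_with_basis scale X nrm e \<longrightarrow>
        banach_space_on.strong_partially_greedy scale X nrm e \<longrightarrow>
        banach_space_on.partially_greedy scale X nrm lam e) \<and>
     (\<forall>(scale :: complex \<Rightarrow> 'b::ab_group_add \<Rightarrow> 'b) X nrm e.
        banach_space_with_basis scale X nrm e \<longrightarrow>
        banach_space_on.strong_partially_greedy scale X nrm e \<longrightarrow>
        banach_space_on.partially_greedy scale X nrm lam e) \<and>
     (\<exists>(scale :: real \<Rightarrow> (nat \<Rightarrow> real) \<Rightarrow> (nat \<Rightarrow> real)) X nrm e.
        banach_space_with_basis scale X nrm e \<and>
        banach_space_on.unconditional scale X nrm e \<and>
        banach_space_on.partially_greedy scale X nrm lam e \<and>
        \<not> banach_space_on.strong_partially_greedy scale X nrm e) \<and>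
     (\<exists>(scale :: complex \<Rightarrow> (nat \<Rightarrow> complex) \<Rightarrow> (nat \<Rightarrow> complex)) X nrm e.
        banach_space_with_basis scale X nrm e \<and>
        banach_space_on.unconditional scale X nrm e \<and>
        banach_space_on.partially_greedy scale X nrm lam e \<and>
        \<not> banach_space_on.strong_partially_greedy scale X nrm e)"
proof (intro conjI)
  have lam: "lam \<ge> 1"
    using assms by simp
  show "\<forall>(scale :: real \<Rightarrow> 'a \<Rightarrow> 'a) X nrm e. banach_space_with_basis scale X nrm e \<longrightarrow>
      banach_space_on.strong_partially_greedy scale X nrm e \<longrightarrow>
      banach_space_on.partially_greedy scale X nrm lam e"
    using banach_space_with_basis.strong_partially_greedy_imp_partially_greedy[OF _ lam] by blast
  show "\<forall>(scale :: complex \<Rightarrow> 'b \<Rightarrow> 'b) X nrm e. banach_space_with_basis scale X nrm e \<longrightarrow>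
      banach_space_on.strong_partially_greedy scale X nrm e \<longrightarrow>
      banach_space_on.partially_greedy scale X nrm lam e"
    using banach_space_with_basis.strong_partially_greedy_imp_partially_greedy[OF _ lam] by blast
qed (rule exI[of _ seq_scale], rule exI[of _ mixed_space], rule exI[of _ mixed_norm],
    rule exI[of _ unit_seq], intro conjI mixed.banach_space_with_basis_unit_seq
      mixed.unconditional_unit_seq mixed_partially_greedy[OF assms] mixed_not_strong_partially_greedy)+

end
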